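(* Assume that the Four Exponentials Conjecture holds: whenever $x_1,x_2$ are two $\mathbb{Q}$-linearly independent complex numbers and $y_1,y_2$ are two $\mathbb{Q}$-linearly independent complex numbers, at least one of the four numbers $\exp(x_iy_j)$ ($i,j\in\{1,2\}$) is transcendental. Let $d\ge 1$ and let $A_1,A_2:\mathbb{R}^d\to\mathbb{R}^d$ be self-adjoint expansive linear maps, both diagonal with respect to the canonical basis of $\mathbb{R}^d$. Then $A_1$ and $A_2$ generate equivalent MRA (i.e. $A_1(\mathbb{Z}^d)\subset\mathbb{Z}^d$, $A_2(\mathbb{Z}^d)\subset\mathbb{Z}^d$ and $\mathcal{E}_{A_1}=\mathcal{E}_{A_2}$) if and only if $(A'_1)^t=A'_2$ for some $t>0$ and, moreover, $A_1$ and $A_2$ are trivially equivalent.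
   Context: $\mathbb{R}^d$ carries the Euclidean norm and $|\cdot|_d$ is $d$-dimensional Lebesgue measure; $B_r=\{\mathbf{x}\in\mathbb{R}^d:\|\mathbf{x}\|<r\}$. A linear map $A:\mathbb{R}^d\to\mathbb{R}^d$ is expansive if all its (complex) eigenvalues have absolute value greater than $1$. For an expansive linear map $A$, $\mathcal{E}_A$ is the family of all measurable sets $E\subset\mathbb{R}^d$ with $|E|_d>0$ for which the origin is a point of $A$-density, i.e. for all $r>0$, $$\lim_{j\to\infty}\frac{|E\cap A^{-j}B_r|_d}{|A^{-j}B_r|_d}=1.$$ Real powers: if $A=CJC^{-1}$ with $C$ invertible and $J$ diagonal with positive diagonal entries $\lambda_1,\dots,\lambda_d$, then $A^t=CJ^tC^{-1}$, where $J^t$ is the diagonal matrix with entries $\lambda_1^t,\dots,\lambda_d^t$. For $\mu=1,2$ write $A_\mu=C_\mu J_\mu C_\mu^{-1}$ with $C_\mu$ invertible and $J_\mu=\mathrm{diag}(\lambda_1^{(\mu)},\dots,\lambda_d^{(\mu)})$ real diagonal; then $A'_\mu=C_\mu J'_\mu C_\mu^{-1}$ with $J'_\mu=\mathrm{diag}(|\lambda_1^{(\mu)}|,\dots,|\lambda_d^{(\mu)}|)$. Trivial equivalence: $A_1$ and $A_2$ are trivially equivalent if $(A'_1)^t=A'_2$ for some $t>0$ such that either (1) $t=p/q$ with $p,q$ positive integers and every $|\lambda_j^{(1)}|$ ($j=1,\dots,d$) is a full $q$-th power of some (possibly different) natural number; or (2) there are natural numbers $a,b$ and positive integers $n_1,\dots,n_d$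 with $|\lambda_j^{(1)}|=a^{n_j}$ for $j=1,\dots,d$, and, with $q=\gcd(n_1,\dots,n_d)$, $t=\frac{m}{q}\cdot\frac{\log b}{\log a}$ for some positive integer $m$. *)

theory Defs
  imports "HOL-Analysis.Analysis" "HOL-Computational_Algebra.Polynomial"
begin

definition rat_independent2 :: "complex \<Rightarrow> complex \<Rightarrow> bool" where
  "rat_independent2 x y \<longleftrightarrow>
     (\<forall>p q :: rat. of_rat p * x + of_rat q * y = 0 \<longrightarrow> p = 0 \<and> q = 0)"

definition four_exponentials_conjecture :: bool where
  "four_exponentials_conjecture \<longleftrightarrow>
     (\<forall>x1 x2 y1 y2 :: complex. rat_independent2 x1 x2 \<longrightarrow> rat_independent2 y1 y2 \<longrightarrow>
        \<not> algebraic (exp (x1 * y1)) \<or> \<not> algebraic (exp (x1 * y2)) \<or>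
        \<not> algebraic (exp (x2 * y1)) \<or> \<not> algebraic (exp (x2 * y2)))"


definition complex_eigenvalue :: "(real ^ 'n \<Rightarrow> real ^ 'n) \<Rightarrow> complex \<Rightarrow> bool" where
  "complex_eigenvalue A \<mu> \<longleftrightarrow>
     (\<exists>v :: complex ^ 'n. v \<noteq> 0 \<and> map_matrix complex_of_real (matrix A) *v v = \<mu> *s v)"

definition expansive :: "(real ^ 'n \<Rightarrow> real ^ 'n) \<Rightarrow> bool" where
  "expansive A \<longleftrightarrow> (\<forall>\<mu>. complex_eigenvalue A \<mu> \<longrightarrow> norm \<mu> > 1)"

text \<open>The image under \<open>inv A ^^ j\<close> is $A^{-j} B_r$; every expansive linear map is bijective.\<close>

definition density_family :: "(real ^ 'n \<Rightarrow> real ^ 'n) \<Rightarrow> (real ^ 'n) set set" where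
  "density_family A =
     {E. E \<in> sets lebesgue \<and> emeasure lebesgue E > 0 \<and>
         (\<forall>r>0. (\<lambda>j. measure lebesgue (E \<inter> (inv A ^^ j) ` ball 0 r)
                     / measure lebesgue ((inv A ^^ j) ` ball 0 r)) \<longlonglongrightarrow> 1)}"

definition integer_lattice :: "(real ^ 'n) set" where
  "integer_lattice = {x. \<forall>i. x $ i \<in> \<int>}"

definition generate_equivalent_MRA ::
  "(real ^ 'n \<Rightarrow> real ^ 'n) \<Rightarrow> (real ^ 'n \<Rightarrow> real ^ 'n) \<Rightarrow> bool" where
  "generate_equivalent_MRA A B \<longleftrightarrow>
     A ` integer_lattice \<subseteq> integer_lattice \<and> B ` integer_lattice \<subseteq> integer_lattice \<and>
     density_family A = density_family B"


definition diag_map :: "('n \<Rightarrow> real) \<Rightarrow> real ^ 'n \<Rightarrow> real ^ 'n" where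
  "diag_map l x = (\<chi> i. l i * x $ i)"

definition diagonalizes :: 
  "(real ^ 'n \<Rightarrow> real ^ 'n) \<Rightarrow> ('n \<Rightarrow> real) \<Rightarrow> (real ^ 'n \<Rightarrow> real ^ 'n) \<Rightarrow> bool" where
  "diagonalizes C l A \<longleftrightarrow> linear C \<and> bij C \<and> A = C \<circ> diag_map l \<circ> inv C"

text \<open>
  \<open>diag_apply f A\<close> replaces $A = C J C^{-1}$ by $C f(J) C^{-1}$, with \<open>f\<close> applied to the diagonal
  entries of $J$. Lemma \<open>diag_apply_eq\<close> shows that the result does not depend on the
  diagonalization.
\<close>

definition diag_apply :: "(real \<Rightarrow> real) \<Rightarrow> (real ^ 'n \<Rightarrow> real ^ 'n) \<Rightarrow> (real ^ 'n \<Rightarrow> real ^ 'n)" where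
  "diag_apply f A =
     (THE B. \<exists>C l. diagonalizes C l A \<and> B = C \<circ> diag_map (\<lambda>i. f (l i)) \<circ> inv C)"

definition abs_map :: "(real ^ 'n \<Rightarrow> real ^ 'n) \<Rightarrow> (real ^ 'n \<Rightarrow> real ^ 'n)" where
  "abs_map A = diag_apply abs A"

text \<open>Meaningful only when the diagonal entries are positive, as for \<open>abs_map A\<close> with \<open>A\<close>
  expansive and diagonalizable.\<close>

definition map_powr :: "(real ^ 'n \<Rightarrow> real ^ 'n) \<Rightarrow> real \<Rightarrow> (real ^ 'n \<Rightarrow> real ^ 'n)" where
  "map_powr A t = diag_apply (\<lambda>x. x powr t) A"

lemma linear_diag_map: "linear (diag_map l)"
  by (rule linearI) (auto simp: diag_map_def vec_eq_iff algebra_simps)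

lemma diag_map_axis: "diag_map l (axis j 1) = l j *\<^sub>R axis j 1"
  by (auto simp: diag_map_def vec_eq_iff axis_def)

lemma diag_apply_eq:
  fixes A :: "real ^ 'n \<Rightarrow> real ^ 'n"
  assumes "diagonalizes C l A"
  shows "diag_apply f A = C \<circ> diag_map (\<lambda>i. f (l i)) \<circ> inv C"
proof -
  have unique: "C' \<circ> diag_map (\<lambda>i. f (l' i)) \<circ> inv C' = C \<circ> diag_map (\<lambda>i. f (l i)) \<circ> inv C"
    if "diagonalizes C' l' A" for C' l'
  proof -
    have C: "linear C" "bij C" and C': "linear C'" "bij C'"
      and eq: "C' \<circ> diag_map l' \<circ> inv C' = C \<circ> diag_map l \<circ> inv C"
      using assms that by (auto simp: diagonalizes_def)
    define M where "M = inv C' \<circ> C"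
    have linM: "linear M"
      unfolding M_def using C(1) C' linear_compose
      by (metis bij_is_inj bij_is_surj inj_linear_imp_inv_linear)
    have M1: "M (diag_map l x) = diag_map l' (M x)" for x
    proof -
      have "C' (diag_map l' (inv C' (C x))) = C (diag_map l (inv C (C x)))"
        using eq by (metis comp_apply)
      then show ?thesis
        unfolding M_def using C C' by (metis bij_def comp_apply inv_f_f)
    qed
    have M2: "M (diag_map (\<lambda>i. f (l i)) x) = diag_map (\<lambda>i. f (l' i)) (M x)" for x
    proof -
      have "M \<circ> diag_map (\<lambda>i. f (l i)) = diag_map (\<lambda>i. f (l' i)) \<circ> M"
      proof (rule linear_eq_stdbasis)
        show "linear (M \<circ> diag_map (\<lambda>i. f (l i)))" "linear (diag_map (\<lambda>i. f (l' i)) \<circ> M)"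
          by (intro linear_compose linM linear_diag_map)+
        fix b :: "real ^ 'n" assume "b \<in> Basis"
        then obtain j where b: "b = axis j 1"
          by (auto simp: Basis_vec_def)
        have "l j * M b $ i = l' i * M b $ i" for i
          using arg_cong[OF M1[of b], of "\<lambda>v. v $ i"] linM
          by (simp add: b diag_map_axis linear_scale) (simp add: diag_map_def)
        then have "f (l j) * M b $ i = f (l' i) * M b $ i" for i
          by (metis mult_cancel_right)
        then show "(M \<circ> diag_map (\<lambda>i. f (l i))) b = (diag_map (\<lambda>i. f (l' i)) \<circ> M) b"
          using linM
          by (simp add: b diag_map_axis linear_scale) (simp add: diag_map_def vec_eq_iff)
      qed
      then show ?thesis by (metis comp_apply)
    qed
    show ?thesis
    proof
      fix y
      have "M (inv C y) = inv C' y"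
        unfolding M_def using C by (simp add: bij_is_surj surj_f_inv_f)
      then have "C' (diag_map (\<lambda>i. f (l' i)) (inv C' y)) = C' (M (diag_map (\<lambda>i. f (l i)) (inv C y)))"
        by (simp add: M2)
      also have "\<dots> = C (diag_map (\<lambda>i. f (l i)) (inv C y))"
        unfolding M_def using C' by (simp add: bij_is_surj surj_f_inv_f)
      finally show "(C' \<circ> diag_map (\<lambda>i. f (l' i)) \<circ> inv C') y
          = (C \<circ> diag_map (\<lambda>i. f (l i)) \<circ> inv C) y" by simp
    qed
  qed
  show ?thesis
    unfolding diag_apply_def
  proof (rule the_equality)
    show "\<exists>C' l'. diagonalizes C' l' A \<and> C \<circ> diag_map (\<lambda>i. f (l i)) \<circ> inv C
        = C' \<circ> diag_map (\<lambda>i. f (l' i)) \<circ> inv C'"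
      using assms by blast
  qed (use unique in blast)
qed

text \<open>The diagonal entries are determined by the map up to a permutation, and both alternatives
  are symmetric in them, so it does not matter which diagonalization is chosen.\<close>

definition trivially_equivalent ::
  "(real ^ 'n \<Rightarrow> real ^ 'n) \<Rightarrow> (real ^ 'n \<Rightarrow> real ^ 'n) \<Rightarrow> bool" where
  "trivially_equivalent A1 A2 \<longleftrightarrow>
     (\<exists>C1 l1 C2 l2. diagonalizes C1 l1 A1 \<and> diagonalizes C2 l2 A2 \<and>
        (\<exists>t>0. map_powr (abs_map A1) t = abs_map A2 \<and>
          ((\<exists>p q :: nat. p > 0 \<and> q > 0 \<and> t = real p / real q \<and>
              (\<forall>j. \<exists>k :: nat. \<bar>l1 j\<bar> = real (k ^ q))) \<or>
           (\<exists>(a :: nat) (b :: nat) (n :: 'n \<Rightarrow> nat) m :: nat.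
              (\<forall>j. n j > 0) \<and> (\<forall>j. \<bar>l1 j\<bar> = real (a ^ n j)) \<and> m > 0 \<and>
              t = real m / real (Gcd (range n)) * (ln (real b) / ln (real a))))))"

end

theory Submission
  imports Defs "HOL-Computational_Algebra.Nth_Powers"
begin

text \<open>
  Write $a_i$ and $b_i$ for the diagonal entries of $A_1$ and $A_2$. The density families agree iff
  $(|b_i|) = (|a_i|^t)$ for some $t > 0$. If such a $t$ exists, $A_2^{-j} B_r$ is contained in
  $A_1^{-k} B_r$ for $k = \lfloor tj \rfloor$, with volumes comparable uniformly in $j$. If not, the
  numbers $\log |a_p| / \log |a_q|$ and $\log |b_p| / \log |b_q|$ differ for some $p, q$; for $s$
  strictly between them, the curved cone $|x_p| < |x_q|^s$ has density 1 at the origin for one of the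
  maps and density 0 for the other, as one sees after rescaling by the map.

  Given $t$, all entries $|a_i|$ and $|a_i|^t$ are integers. If $t = p/q$ in lowest terms, comparing
  prime multiplicities shows that the $|a_i|$ are $q$-th powers. If $t$ is irrational, the Four
  Exponentials Conjecture for $1, t$ and $\log |a_i|, \log |a_j|$ makes the ratios of these logarithms
  rational, so the $|a_i|$ are powers of one natural number $a$ with coprime exponents, and the same
  divisibility argument shows that $a^t$ is a natural number.
\<close>

section \<open>Diagonal maps\<close>

lemma diag_map_nth [simp]: "diag_map c x $ i = c i * x $ i"
  by (simp add: diag_map_def)

lemma diag_map_eq_iff: "diag_map c = diag_map d \<longleftrightarrow> c = d"
proof
  assume eq: "diag_map c = diag_map d"
  show "c = d"
  proof
    fix i
    have "diag_map c (axis i 1) $ i = diag_map d (axis i 1) $ i"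
      by (simp add: eq)
    then show "c i = d i"
      by (simp add: axis_def)
  qed
qed simp

lemma diagonalizes_id: "diagonalizes id c (diag_map c)"
  by (simp add: diagonalizes_def linear_id)

lemma diag_apply_diag_map: "diag_apply f (diag_map c) = diag_map (\<lambda>i. f (c i))"
  using diag_apply_eq[OF diagonalizes_id, of f c] by simp

lemma map_powr_diag_map: "map_powr (diag_map c) t = diag_map (\<lambda>i. c i powr t)"
  by (simp add: map_powr_def diag_apply_diag_map)

lemma abs_map_diag_map: "abs_map (diag_map c) = diag_map (\<lambda>i. \<bar>c i\<bar>)"
  by (simp add: abs_map_def diag_apply_diag_map)

lemma matrix_diag_map: "matrix (diag_map c) = (\<chi> i j. if i = j then c i else 0)"
  by (auto simp: matrix_def vec_eq_iff axis_def)

lemma diag_map_diag_map: "diag_map c (diag_map d x) = diag_map (\<lambda>i. c i * d i) x"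
  by (simp add: vec_eq_iff)

lemma diag_map_one [simp]: "diag_map (\<lambda>i. 1) x = x"
  by (simp add: vec_eq_iff)

lemma inv_diag_map:
  assumes "\<And>i. c i \<noteq> 0"
  shows "inv (diag_map c) = diag_map (\<lambda>i. inverse (c i))"
  by (rule inv_equality) (simp_all add: diag_map_diag_map assms)

lemma diag_map_image_eq_vimage:
  assumes "\<And>i. c i \<noteq> 0"
  shows "diag_map c ` S = diag_map (\<lambda>i. inverse (c i)) -` S"
proof (intro set_eqI iffI)
  fix x assume x: "x \<in> diag_map (\<lambda>i. inverse (c i)) -` S"
  have "x = diag_map c (diag_map (\<lambda>i. inverse (c i)) x)"
    using assms by (simp add: diag_map_diag_map)
  then show "x \<in> diag_map c ` S"
    using x by blast
qed (use assms in \<open>auto simp: diag_map_diag_map\<close>)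

lemma diag_map_funpow: "diag_map c ^^ j = diag_map (\<lambda>i. c i ^ j)"
  by (induction j) (auto simp: fun_eq_iff diag_map_diag_map)

lemma inv_diag_map_funpow:
  assumes "\<And>i. c i \<noteq> 0"
  shows "inv (diag_map c) ^^ j = diag_map (\<lambda>i. inverse (c i) ^ j)"
  by (simp add: inv_diag_map[OF assms] diag_map_funpow)

text \<open>The preimage of a coordinate vector under \<open>C\<close> is a nonzero eigenvector of
  \<open>diag_map l\<close> with eigenvalue \<open>c i\<close>, and any nonzero coordinate of it
  singles out a suitable \<open>k\<close>. This transfers conditions on the entries of an arbitrary
  diagonalization to the entries in the canonical basis.\<close>

lemma diagonalizes_diag_map_entry:
  assumes "diagonalizes C l (diag_map c)"
  shows "\<exists>k. l k = c i"
proof -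
  have C: "linear C" "bij C" and eq: "diag_map c = C \<circ> diag_map l \<circ> inv C"
    using assms by (auto simp: diagonalizes_def)
  define v where "v = inv C (axis i 1)"
  have Cv: "C v = axis i 1"
    using C by (simp add: v_def bij_is_surj surj_f_inv_f)
  have "v \<noteq> 0"
  proof
    assume "v = 0"
    then have "axis i (1::real) = 0"
      using Cv linear_0[OF C(1)] by metis
    then show False
      by (simp add: axis_eq_0_iff)
  qed
  then obtain k where k: "v $ k \<noteq> 0"
    by (auto simp: vec_eq_iff)
  have "C (diag_map l v) = c i *\<^sub>R axis i 1"
    using eq diag_map_axis[of c i] by (metis comp_apply v_def)
  also have "\<dots> = C (c i *\<^sub>R v)"
    by (simp add: linear_scale[OF C(1)] Cv)
  finally have "diag_map l v = c i *\<^sub>R v"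
    using C(2) by (simp add: bij_is_inj inj_eq)
  then have "l k * v $ k = c i * v $ k"
    by (metis diag_map_nth vector_scaleR_component real_scaleR_def)
  with k show ?thesis by auto
qed

text \<open>Each coordinate vector is a complex eigenvector with eigenvalue
  \<open>c i\<close>.\<close>

lemma expansive_diag_mapD:
  fixes c :: "'n::finite \<Rightarrow> real"
  assumes "expansive (diag_map c)"
  shows "\<bar>c i\<bar> > 1"
proof -
  have delta: "(\<Sum>j\<in>UNIV. f j * (if j = i then 1 else 0)) = f i" for f :: "'n \<Rightarrow> complex"
    by (subst sum.remove[of _ i]) (auto intro!: sum.neutral)
  have "map_matrix complex_of_real (matrix (diag_map c)) *v axis i 1 = complex_of_real (c i) *s axis i 1"
    by (auto simp: vec_eq_iff matrix_vector_mult_def matrix_diag_map axis_def map_matrix_def delta intro!: sum.neutral)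
  moreover have "axis i (1::complex) \<noteq> 0"
    by (simp add: axis_eq_0_iff)
  ultimately have "complex_eigenvalue (diag_map c) (complex_of_real (c i))"
    unfolding complex_eigenvalue_def by blast
  then show ?thesis
    using assms by (auto simp: expansive_def)
qed

lemma diag_map_integer_lattice_iff:
  fixes c :: "'n::finite \<Rightarrow> real"
  shows "diag_map c ` integer_lattice \<subseteq> integer_lattice \<longleftrightarrow> (\<forall>i. c i \<in> \<int>)"
proof (intro iffI allI)
  fix i assume "diag_map c ` integer_lattice \<subseteq> integer_lattice"
  moreover have "axis i 1 \<in> (integer_lattice :: (real^'n) set)"
    by (auto simp: integer_lattice_def axis_def)
  ultimately have "diag_map c (axis i 1) \<in> integer_lattice" by blast
  then have "diag_map c (axis i 1) $ i \<in> \<int>"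
    unfolding integer_lattice_def by blast
  then show "c i \<in> \<int>"
    by (simp add: axis_def)
qed (auto simp: integer_lattice_def)

section \<open>Density families of diagonal maps\<close>

lemma lebesgue_diag_map:
  fixes c :: "'n::finite \<Rightarrow> real"
  assumes c: "\<And>i. c i \<noteq> 0"
  shows "lebesgue = density (distr lebesgue lebesgue (diag_map c)) (\<lambda>_. ennreal (\<Prod>i\<in>UNIV. \<bar>c i\<bar>))"
    and "diag_map c \<in> lebesgue \<rightarrow>\<^sub>M lebesgue"
proof -
  have Basis: "(Basis :: (real^'n) set) = range (\<lambda>i. axis i 1)"
    by (auto simp: Basis_vec_def)
  have inj: "inj (\<lambda>i::'n. axis i (1::real))"
    by (auto simp: inj_on_def axis_eq_axis)
  \<comment> \<open>The change of variables formula expects factors indexed by basis vectors;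
    \<open>cB\<close> re-indexes \<open>c\<close> accordingly, with translation vector 0.\<close>
  define cB where "cB b = diag_map c b \<bullet> b" for b
  have cB: "cB (axis i 1) = c i" for i
    unfolding cB_def inner_axis by (simp add: axis_def)
  have T: "(\<lambda>x. 0 + (\<Sum>j\<in>Basis. (cB j * (x \<bullet> j)) *\<^sub>R j)) = diag_map c"
  proof
    fix x :: "real^'n"
    have "(\<Sum>j\<in>Basis. (cB j * (x \<bullet> j)) *\<^sub>R j) = (\<Sum>i\<in>UNIV. (c i * x $ i) *\<^sub>R axis i 1)"
      unfolding Basis by (simp add: sum.reindex[OF inj] cB inner_axis)
    also have "\<dots> = diag_map c x"
      by (simp add: vec_eq_iff axis_def if_distrib cong: if_cong)
    finally show "0 + (\<Sum>j\<in>Basis. (cB j * (x \<bullet> j)) *\<^sub>R j) = diag_map c x" by simp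
  qed
  have "(\<Prod>j\<in>Basis. \<bar>cB j\<bar>) = (\<Prod>i\<in>UNIV. \<bar>c i\<bar>)"
    unfolding Basis by (simp add: prod.reindex[OF inj] cB)
  moreover have "cB j \<noteq> 0" if "j \<in> Basis" for j
    using that c by (auto simp: Basis cB)
  ultimately show "lebesgue = density (distr lebesgue lebesgue (diag_map c)) (\<lambda>_. ennreal (\<Prod>i\<in>UNIV. \<bar>c i\<bar>))"
    "diag_map c \<in> lebesgue \<rightarrow>\<^sub>M lebesgue"
    using lebesgue_affine_euclidean[of cB 0] lebesgue_affine_measurable[of cB 0] unfolding T by auto
qed

lemma emeasure_diag_map_image:
  fixes c :: "'n::finite \<Rightarrow> real"
  assumes c: "\<And>i. c i \<noteq> 0" and S: "S \<in> sets lebesgue"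
  shows "diag_map c ` S \<in> sets lebesgue"
    and "emeasure lebesgue (diag_map c ` S) = ennreal (\<Prod>i\<in>UNIV. \<bar>c i\<bar>) * emeasure lebesgue S"
proof -
  have eq: "diag_map c ` S = diag_map (\<lambda>i. inverse (c i)) -` S \<inter> space lebesgue"
    using c by (simp add: diag_map_image_eq_vimage)
  show "diag_map c ` S \<in> sets lebesgue"
    unfolding eq using c S by (intro measurable_sets[OF lebesgue_diag_map(2)]) auto
  \<comment> \<open>The formula is applied to the inverse scaling, whose preimage of
    \<open>S\<close> is the image of \<open>S\<close> under \<open>diag_map c\<close>; the
    determinants then cancel.\<close>
  note T = lebesgue_diag_map[of "\<lambda>i. inverse (c i)"]
  have "emeasure lebesgue S = emeasure (density (distr lebesgue lebesgue (diag_map (\<lambda>i. inverse (c i))))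
      (\<lambda>_. ennreal (\<Prod>i\<in>UNIV. \<bar>inverse (c i)\<bar>))) S"
    using T(1) c by (metis inverse_nonzero_iff_nonzero)
  also have "\<dots> = ennreal (\<Prod>i\<in>UNIV. \<bar>inverse (c i)\<bar>) * emeasure (distr lebesgue lebesgue (diag_map (\<lambda>i. inverse (c i)))) S"
    using S by (subst emeasure_density) (simp_all add: nn_integral_cmult)
  also have "\<dots> = ennreal (\<Prod>i\<in>UNIV. \<bar>inverse (c i)\<bar>) * emeasure lebesgue (diag_map c ` S)"
    using S c by (subst emeasure_distr[OF T(2)]) (simp_all add: eq)
  finally have im: "emeasure lebesgue S = ennreal (\<Prod>i\<in>UNIV. \<bar>inverse (c i)\<bar>) * emeasure lebesgue (diag_map c ` S)" .
  have "ennreal (\<Prod>i\<in>UNIV. \<bar>c i\<bar>) * ennreal (\<Prod>i\<in>UNIV. \<bar>inverse (c i)\<bar>) = 1"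
    using c by (simp add: prod_nonneg flip: ennreal_mult prod.distrib abs_mult)
  then show "emeasure lebesgue (diag_map c ` S) = ennreal (\<Prod>i\<in>UNIV. \<bar>c i\<bar>) * emeasure lebesgue S"
    by (simp add: im flip: mult.assoc del: emeasure_completion)
qed

lemma measure_diag_map_image:
  fixes c :: "'n::finite \<Rightarrow> real"
  assumes c: "\<And>i. c i \<noteq> 0" and S: "S \<in> lmeasurable"
  shows "diag_map c ` S \<in> lmeasurable"
    and "measure lebesgue (diag_map c ` S) = (\<Prod>i\<in>UNIV. \<bar>c i\<bar>) * measure lebesgue S"
proof -
  have "S \<in> sets lebesgue" using S by auto
  note im = emeasure_diag_map_image[of c, OF c this]
  show "diag_map c ` S \<in> lmeasurable"
    using S im by (auto simp: fmeasurable_def ennreal_mult_less_top simp del: emeasure_completion)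
  show "measure lebesgue (diag_map c ` S) = (\<Prod>i\<in>UNIV. \<bar>c i\<bar>) * measure lebesgue S"
    unfolding measure_def im(2) by (simp add: enn2real_mult prod_nonneg)
qed

lemma measure_diag_map_ball_pos:
  fixes c :: "'n::finite \<Rightarrow> real"
  assumes "\<And>i. c i \<noteq> 0" "r > 0"
  shows "measure lebesgue (diag_map c ` ball 0 r) > 0"
  using assms content_ball_pos[of r "0::real^'n"]
  by (simp add: measure_diag_map_image prod_pos)

text \<open>\<open>diag_map c\<close> factors as \<open>diag_map d\<close> after the scaling by
  \<open>c i / d i\<close>, which does not increase the norm.\<close>

lemma diag_map_image_ball_subset:
  assumes "\<And>i. \<bar>c i\<bar> \<le> \<bar>d i\<bar>" "\<And>i. d i \<noteq> 0"
  shows "diag_map c ` ball 0 r \<subseteq> diag_map d ` ball 0 r"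
proof
  fix x assume "x \<in> diag_map c ` ball 0 r"
  then obtain u where u: "norm u < r" "x = diag_map c u" by auto
  have "\<bar>c i / d i\<bar> * \<bar>u $ i\<bar> \<le> 1 * \<bar>u $ i\<bar>" for i
    using assms by (intro mult_right_mono) auto
  then have "norm (diag_map (\<lambda>i. c i / d i) u) \<le> norm u"
    by (intro norm_le_componentwise_cart) (simp add: abs_mult)
  moreover have "x = diag_map d (diag_map (\<lambda>i. c i / d i) u)"
    using assms(2) by (simp add: u diag_map_diag_map)
  ultimately show "x \<in> diag_map d ` ball 0 r"
    using u(1) by auto
qed

section \<open>Densities along shrinking ellipsoids\<close>

text \<open>Substituting \<open>x = diag_map c u\<close> multiplies numerator and denominator by the
  same determinant. The shrinking ellipsoids are thereby replaced by one fixed ball, and only the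
  rescaled copy of \<open>E\<close> varies.\<close>

lemma diag_map_density_ratio:
  fixes c :: "'n::finite \<Rightarrow> real"
  assumes E: "E \<in> sets lebesgue" and c: "\<And>i. c i \<noteq> 0"
  shows "measure lebesgue (E \<inter> diag_map c ` ball 0 r) / measure lebesgue (diag_map c ` ball 0 r)
       = measure lebesgue {u \<in> ball 0 r. diag_map c u \<in> E} / measure lebesgue (ball (0::real^'n) r)"
proof -
  let ?S = "{u \<in> ball 0 r. diag_map c u \<in> E}"
  have "{u. diag_map c u \<in> E} = diag_map (\<lambda>i. inverse (c i)) ` E"
    using c by (subst diag_map_image_eq_vimage) (auto simp: vimage_def)
  then have eq: "?S = diag_map (\<lambda>i. inverse (c i)) ` (E \<inter> diag_map c ` ball 0 r)"
    using c by (auto simp: diag_map_image_eq_vimage diag_map_diag_map)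
  have "E \<inter> diag_map c ` ball 0 r \<in> lmeasurable"
    using E measure_diag_map_image(1)[of c "ball 0 r", OF c]
    by (metis Int_commute fmeasurable_Int_fmeasurable lmeasurable_ball)
  then have "?S \<in> lmeasurable"
    unfolding eq using c by (intro measure_diag_map_image) auto
  moreover have "E \<inter> diag_map c ` ball 0 r = diag_map c ` ?S" by auto
  ultimately have "measure lebesgue (E \<inter> diag_map c ` ball 0 r) = (\<Prod>i\<in>UNIV. \<bar>c i\<bar>) * measure lebesgue ?S"
    using measure_diag_map_image(2)[of c ?S] c by metis
  moreover have "(\<Prod>i\<in>UNIV. \<bar>c i\<bar>) \<noteq> 0"
    using c by simp
  ultimately show ?thesis
    using c by (simp add: measure_diag_map_image)
qed

lemma diag_map_mem_density_family_iff:
  assumes "\<And>i. c i \<noteq> 0"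
  shows "E \<in> density_family (diag_map c) \<longleftrightarrow>
    E \<in> sets lebesgue \<and> emeasure lebesgue E > 0 \<and>
    (\<forall>r>0. (\<lambda>j. measure lebesgue (E \<inter> diag_map (\<lambda>i. inverse (c i) ^ j) ` ball 0 r)
        / measure lebesgue (diag_map (\<lambda>i. inverse (c i) ^ j) ` ball 0 r)) \<longlonglongrightarrow> 1)"
  by (simp add: density_family_def inv_diag_map_funpow[OF assms])

text \<open>The part of \<open>P\<close> missed by \<open>E\<close> lies in the part of
  \<open>Q\<close> missed by \<open>E\<close>, and passing from \<open>measure lebesgue Q\<close> to
  \<open>measure lebesgue P\<close> in the denominator costs at most a factor \<open>M\<close>.
  Density 1 along the larger sets thus passes to comparable subsets.\<close>

lemma density_deficit_mono:
  assumes P: "P \<in> lmeasurable" and Q: "Q \<in> lmeasurable" and E: "E \<in> sets lebesgue"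
    and sub: "P \<subseteq> Q" and pos: "measure lebesgue P > 0"
    and le: "measure lebesgue Q \<le> M * measure lebesgue P"
  shows "1 - measure lebesgue (E \<inter> P) / measure lebesgue P
    \<le> M * (1 - measure lebesgue (E \<inter> Q) / measure lebesgue Q)"
proof -
  have deficit: "1 - measure lebesgue (E \<inter> R) / measure lebesgue R
      = measure lebesgue (R - E) / measure lebesgue R"
    if "R \<in> lmeasurable" "measure lebesgue R > 0" for R
  proof -
    have "E \<inter> R \<in> lmeasurable"
      using that E by (metis Int_commute fmeasurable_Int_fmeasurable)
    then have "measure lebesgue (R - E \<inter> R) = measure lebesgue R - measure lebesgue (E \<inter> R)"
      using that by (intro measurable_measure_Diff) auto
    moreover have "R - E \<inter> R = R - E" by auto
    ultimately show ?thesis using that by (simp add: diff_divide_distrib)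
  qed
  have posQ: "measure lebesgue Q > 0"
    using measure_mono_fmeasurable[OF sub _ Q] P pos by fastforce
  have "measure lebesgue (P - E) \<le> measure lebesgue (Q - E)"
    using P Q E sub by (intro measure_mono_fmeasurable fmeasurable_Diff) auto
  then have "measure lebesgue (P - E) * measure lebesgue Q
      \<le> measure lebesgue (Q - E) * (M * measure lebesgue P)"
    using le by (intro mult_mono) auto
  then show ?thesis
    unfolding deficit[OF P pos] deficit[OF Q posQ] using pos posQ by (simp add: field_simps)
qed

lemma density_family_powr_subset:
  fixes a b :: "'n::finite \<Rightarrow> real"
  assumes a: "\<And>i. \<bar>a i\<bar> > 1" and t: "t > 0" and b: "\<And>i. \<bar>b i\<bar> = \<bar>a i\<bar> powr t"
  shows "density_family (diag_map a) \<subseteq> density_family (diag_map b)"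
proof
  fix E assume "E \<in> density_family (diag_map a)"
  have a0: "a i \<noteq> 0" for i using a[of i] by auto
  have b0: "b i \<noteq> 0" for i using b[of i] a0[of i] by auto
  let ?Q = "\<lambda>r k. diag_map (\<lambda>i. inverse (a i) ^ k) ` ball 0 r"
  let ?P = "\<lambda>r k. diag_map (\<lambda>i. inverse (b i) ^ k) ` ball 0 r"
  have E: "E \<in> sets lebesgue" "emeasure lebesgue E > 0"
    and lim: "\<And>r. r > 0 \<Longrightarrow> (\<lambda>k. measure lebesgue (E \<inter> ?Q r k) / measure lebesgue (?Q r k)) \<longlonglongrightarrow> 1"
    using \<open>E \<in> _\<close> by (auto simp: diag_map_mem_density_family_iff[OF a0])
  \<comment> \<open>The entries of the \<open>j\<close>-th inverse power of the second map have
    modulus \<open>\<bar>a i\<bar> powr (- (t * real j))\<close>. Rounding the exponent down gives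
    an ellipsoid \<open>?Q r (k j)\<close> containing \<open>?P r j\<close>.\<close>
  define k where "k j = nat \<lfloor>t * real j\<rfloor>" for j
  have k: "real (k j) \<le> t * real j" "t * real j \<le> real (k j) + 1" for j
    using t by (auto simp: k_def of_nat_nat)
  have klim: "filterlim k at_top sequentially"
    unfolding k_def
    by (intro filterlim_compose[OF filterlim_nat_sequentially] filterlim_compose[OF filterlim_floor_sequentially]
        filterlim_tendsto_pos_mult_at_top[OF tendsto_const t] filterlim_real_sequentially)
  \<comment> \<open>The exponents differ by at most 1, so in each coordinate the larger ellipsoid is
    longer by a factor of at most \<open>\<bar>a i\<bar>\<close>; \<open>M\<close> bounds the volume
    ratio independently of \<open>j\<close>.\<close>
  define M where "M = (\<Prod>i\<in>UNIV. \<bar>a i\<bar>)"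
  have pa: "\<bar>inverse (a i) ^ m\<bar> = \<bar>a i\<bar> powr (- real m)" for i m
    using a0[of i] by (simp add: abs_inverse power_abs powr_minus powr_realpow power_inverse)
  have pb: "\<bar>inverse (b i) ^ j\<bar> = \<bar>a i\<bar> powr (- (t * real j))" for i j
    using a0[of i] b0[of i]
    by (simp add: abs_inverse power_abs b powr_minus powr_powr power_inverse flip: powr_realpow)
  have "(\<lambda>j. measure lebesgue (E \<inter> ?P r j) / measure lebesgue (?P r j)) \<longlonglongrightarrow> 1" if r: "r > 0" for r
  proof -
    have meas: "?P r j \<in> lmeasurable" "?Q r j \<in> lmeasurable" for j
      using a0 b0 by (simp_all add: measure_diag_map_image)
    have pos: "measure lebesgue (?P r j) > 0" for j
      using b0 r by (intro measure_diag_map_ball_pos) auto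
    have sub: "?P r j \<subseteq> ?Q r (k j)" for j
      using a a0 k(1)[of j] unfolding pa pb
      by (intro diag_map_image_ball_subset) (auto simp: pa pb intro!: powr_mono less_imp_le[OF a])
    have le: "measure lebesgue (?Q r (k j)) \<le> M * measure lebesgue (?P r j)" for j
    proof -
      have "(\<Prod>i\<in>UNIV. \<bar>inverse (a i) ^ k j\<bar>) \<le> (\<Prod>i\<in>UNIV. \<bar>a i\<bar> * \<bar>inverse (b i) ^ j\<bar>)"
      proof (intro prod_mono conjI)
        fix i
        have "\<bar>a i\<bar> powr (- real (k j)) \<le> \<bar>a i\<bar> powr (1 + - (t * real j))"
          using a[of i] k(2)[of j] by (intro powr_mono) auto
        then show "\<bar>inverse (a i) ^ k j\<bar> \<le> \<bar>a i\<bar> * \<bar>inverse (b i) ^ j\<bar>"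
          using a0[of i] unfolding pa pb powr_add by simp
      qed auto
      then have "(\<Prod>i\<in>UNIV. \<bar>inverse (a i) ^ k j\<bar>) * measure lebesgue (ball (0::real^'n) r)
          \<le> (\<Prod>i\<in>UNIV. \<bar>a i\<bar> * \<bar>inverse (b i) ^ j\<bar>) * measure lebesgue (ball (0::real^'n) r)"
        by (intro mult_right_mono) auto
      then show ?thesis
        using a0 b0 measure_diag_map_image(2)[of "\<lambda>i. inverse (a i) ^ k j" "ball 0 r"]
          measure_diag_map_image(2)[of "\<lambda>i. inverse (b i) ^ j" "ball 0 r"]
        by (simp add: M_def prod.distrib mult.assoc del: power_inverse)
    qed
    have up: "measure lebesgue (E \<inter> ?P r j) / measure lebesgue (?P r j) \<le> 1" for j
      using meas(1)[of j] pos[of j] E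
      by (simp add: measure_mono_fmeasurable)
    \<comment> \<open>As \<open>k\<close> tends to infinity, the deficit along
      \<open>?Q r (k j)\<close> tends to 0, and the density along \<open>?P r j\<close> is squeezed
      between this expression and 1.\<close>
    have "(\<lambda>j. 1 - M * (1 - measure lebesgue (E \<inter> ?Q r (k j)) / measure lebesgue (?Q r (k j))))
        \<longlonglongrightarrow> 1 - M * (1 - 1)"
      by (intro tendsto_intros filterlim_compose[OF lim[OF r] klim])
    then have low: "(\<lambda>j. 1 - M * (1 - measure lebesgue (E \<inter> ?Q r (k j)) / measure lebesgue (?Q r (k j))))
        \<longlonglongrightarrow> 1" by simp
    have "1 - M * (1 - measure lebesgue (E \<inter> ?Q r (k j)) / measure lebesgue (?Q r (k j)))
       \<le> measure lebesgue (E \<inter> ?P r j) / measure lebesgue (?P r j)" for j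
      using density_deficit_mono[OF meas(1) meas(2) E(1) sub pos le] by (simp add: algebra_simps)
    then show ?thesis
      by (intro tendsto_sandwich[OF _ _ low tendsto_const]) (auto simp: up)
  qed
  then show "E \<in> density_family (diag_map b)"
    using E by (simp add: diag_map_mem_density_family_iff[OF b0])
qed

section \<open>Curved cones that separate density families\<close>

text \<open>\<open>G j\<close> is a rescaled curved cone cut off at radius \<open>r\<close>. For
  \<open>\<kappa> > 1\<close> these sets increase and exhaust the ball outside the hyperplane
  \<open>u $ q = 0\<close>; for \<open>\<kappa> < 1\<close> they decrease to a subset of the
  hyperplane \<open>u $ p = 0\<close>. Hyperplanes are null sets, so continuity of measure gives
  both limits.\<close>

lemma curved_cone_density:
  fixes r s \<kappa> :: real and p q :: "'n::finite"
  defines "G \<equiv> \<lambda>j. {u \<in> ball (0::real^'n) r. \<bar>u $ p\<bar> < \<kappa> ^ j * \<bar>u $ q\<bar> powr s}"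
  assumes s: "s > 0" and \<kappa>: "\<kappa> > 0"
  shows "\<kappa> > 1 \<Longrightarrow> (\<lambda>j. measure lebesgue (G j)) \<longlonglongrightarrow> measure lebesgue (ball (0::real^'n) r)"
    and "\<kappa> < 1 \<Longrightarrow> (\<lambda>j. measure lebesgue (G j)) \<longlonglongrightarrow> 0"
proof -
  have "open (G j)" for j
  proof -
    have "G j = ball 0 r \<inter> {u. \<bar>u $ p\<bar> < \<kappa> ^ j * \<bar>u $ q\<bar> powr s}"
      by (auto simp: G_def)
    also have "open \<dots>"
      \<comment> \<open>Positivity of \<open>s\<close> makes the power continuous also where
        \<open>u $ q\<close> vanishes.\<close>
      using s by (intro open_Int open_ball open_Collect_less continuous_intros continuous_on_powr') auto
    finally show ?thesis .
  qed
  then have G: "G j \<in> sets lebesgue" for j by (simp add: lborelD)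
  have sub: "G j \<subseteq> ball 0 r" for j by (auto simp: G_def)
  have fin: "emeasure lebesgue (G j) \<noteq> \<infinity>" for j
    using emeasure_mono[of "G j" "ball 0 r" lebesgue] emeasure_lborel_ball_finite[of "0::real^'n" r]
      sub[of j] by (auto simp: top_unique)
  { assume "\<kappa> > 1"
    have "incseq G"
      unfolding G_def incseq_def
    proof (intro allI impI subsetI CollectI conjI; elim CollectE conjE)
      fix m n :: nat and u :: "real^'n" assume "m \<le> n" and u: "\<bar>u $ p\<bar> < \<kappa> ^ m * \<bar>u $ q\<bar> powr s"
      note u
      also have "\<kappa> ^ m * \<bar>u $ q\<bar> powr s \<le> \<kappa> ^ n * \<bar>u $ q\<bar> powr s"
        using \<open>\<kappa> > 1\<close> \<open>m \<le> n\<close> by (intro mult_right_mono power_increasing) auto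
      finally show "\<bar>u $ p\<bar> < \<kappa> ^ n * \<bar>u $ q\<bar> powr s" .
    qed
    moreover have subU: "(\<Union>j. G j) \<subseteq> ball 0 r" by (auto simp: G_def)
    then have "emeasure lebesgue (\<Union>j. G j) \<noteq> \<infinity>"
      using emeasure_mono[of "\<Union>j. G j" "ball 0 r" lebesgue] emeasure_lborel_ball_finite[of "0::real^'n" r]
      by (auto simp: top_unique)
    ultimately have "(\<lambda>j. measure lebesgue (G j)) \<longlonglongrightarrow> measure lebesgue (\<Union>j. G j)"
      using G by (intro Lim_measure_incseq) auto
    moreover have "ball 0 r - (\<Union>j. G j) \<subseteq> {u. u $ q = 0}"
    proof
      fix u assume u: "u \<in> ball 0 r - (\<Union>j. G j)"
      show "u \<in> {u. u $ q = 0}"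
      proof (rule ccontr)
        assume "u \<notin> {u. u $ q = 0}"
        then have pos: "\<bar>u $ q\<bar> powr s > 0" by simp
        \<comment> \<open>Off the hyperplane this quotient is a fixed real number, which the powers
          of \<open>\<kappa>\<close> eventually exceed.\<close>
        obtain j where "\<bar>u $ p\<bar> / \<bar>u $ q\<bar> powr s < \<kappa> ^ j"
          using real_arch_pow[OF \<open>\<kappa> > 1\<close>] by blast
        then have "u \<in> G j"
          using u pos by (simp add: G_def field_simps)
        then show False using u by blast
      qed
    qed
    then have "negligible (ball 0 r - (\<Union>j. G j))"
      using negligible_subset negligible_standard_hyperplane_cart by blast
    then have "measure lebesgue (\<Union>j. G j) = measure lebesgue (ball (0::real^'n) r)"
      using subU by (intro measure_negligible_symdiff lmeasurable_ball) (simp add: Diff_eq_empty_iff[THEN iffD2])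
    ultimately show "(\<lambda>j. measure lebesgue (G j)) \<longlonglongrightarrow> measure lebesgue (ball (0::real^'n) r)"
      by simp
  }
  { assume "\<kappa> < 1"
    have "decseq G"
      unfolding G_def decseq_def
    proof (intro allI impI subsetI CollectI conjI; elim CollectE conjE)
      fix m n :: nat and u :: "real^'n" assume "m \<le> n" and u: "\<bar>u $ p\<bar> < \<kappa> ^ n * \<bar>u $ q\<bar> powr s"
      note u
      also have "\<kappa> ^ n * \<bar>u $ q\<bar> powr s \<le> \<kappa> ^ m * \<bar>u $ q\<bar> powr s"
        using \<open>\<kappa> < 1\<close> \<kappa> \<open>m \<le> n\<close> by (intro mult_right_mono power_decreasing) auto
      finally show "\<bar>u $ p\<bar> < \<kappa> ^ m * \<bar>u $ q\<bar> powr s" .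
    qed
    then have "(\<lambda>j. measure lebesgue (G j)) \<longlonglongrightarrow> measure lebesgue (\<Inter>j. G j)"
      using G fin by (intro Lim_measure_decseq) auto
    moreover have "(\<Inter>j. G j) \<subseteq> {u. u $ p = 0}"
    proof
      fix u assume u: "u \<in> (\<Inter>j. G j)"
      have "(\<lambda>j. \<kappa> ^ j * \<bar>u $ q\<bar> powr s) \<longlonglongrightarrow> 0 * \<bar>u $ q\<bar> powr s"
        using \<kappa> \<open>\<kappa> < 1\<close> by (intro tendsto_intros LIMSEQ_power_zero) auto
      moreover have "\<bar>u $ p\<bar> \<le> \<kappa> ^ j * \<bar>u $ q\<bar> powr s" for j
        using u by (auto simp: G_def intro: less_imp_le)
      ultimately have "\<bar>u $ p\<bar> \<le> 0 * \<bar>u $ q\<bar> powr s"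
        by (intro LIMSEQ_le_const) auto
      then show "u \<in> {u. u $ p = 0}" by simp
    qed
    then have "negligible (\<Inter>j. G j)"
      using negligible_subset negligible_standard_hyperplane_cart by blast
    then have "measure lebesgue (\<Inter>j. G j) = 0"
      by (simp add: negligible_imp_measure0)
    ultimately show "(\<lambda>j. measure lebesgue (G j)) \<longlonglongrightarrow> 0" by simp
  }
qed

text \<open>If the inequality failed, a curved cone with exponent \<open>s\<close> strictly between
  the two ratios would have density 1 at the origin for \<open>b\<close> and density 0 for
  \<open>a\<close>, against the inclusion.\<close>

lemma ln_ratio_le_of_density_family_subset:
  fixes a b :: "'n::finite \<Rightarrow> real"
  assumes a: "\<And>i. \<bar>a i\<bar> > 1" and b: "\<And>i. \<bar>b i\<bar> > 1"
    and sub: "density_family (diag_map b) \<subseteq> density_family (diag_map a)"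
  shows "ln \<bar>b p\<bar> / ln \<bar>b q\<bar> \<le> ln \<bar>a p\<bar> / ln \<bar>a q\<bar>"
proof (rule ccontr)
  assume "\<not> ?thesis"
  then obtain s where s: "ln \<bar>a p\<bar> / ln \<bar>a q\<bar> < s" "s < ln \<bar>b p\<bar> / ln \<bar>b q\<bar>"
    using dense by (meson not_le)
  have ln0: "ln \<bar>a i\<bar> > 0" "ln \<bar>b i\<bar> > 0" for i
    using a[of i] b[of i] by auto
  \<comment> \<open>For \<open>p = q\<close> both ratios would be 1, leaving no room for
    \<open>s\<close>. Distinctness places \<open>axis q 1\<close> in \<open>E\<close>, so
    \<open>E\<close> is a nonempty open set and has positive measure.\<close>
  have "p \<noteq> q"
    using s ln0[of p] by auto
  have s0: "s > 0"
    using s(1) divide_pos_pos[OF ln0(1)[of p] ln0(1)[of q]] by linarith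
  define E where "E = {x::real^'n. \<bar>x $ p\<bar> < \<bar>x $ q\<bar> powr s}"
  have "open E"
    unfolding E_def using s0
    by (intro open_Collect_less continuous_intros continuous_on_powr') auto
  then have Em: "E \<in> sets lebesgue" by (simp add: lborelD)
  have "axis q 1 \<in> E"
    using \<open>p \<noteq> q\<close> by (simp add: E_def axis_def)
  then have "\<not> negligible E"
    using open_not_negligible[OF \<open>open E\<close>] by auto
  then have Epos: "emeasure lebesgue E > 0"
    using Em negligible_iff_emeasure0 not_gr_zero by blast
  \<comment> \<open>Inserting the point with coordinates \<open>inverse (c i) ^ j * u $ i\<close>
    into the inequality defining \<open>E\<close> and clearing denominators leaves the factor
    \<open>\<kappa> c ^ j\<close>. Whether \<open>\<kappa> c\<close> exceeds 1 depends on the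
    position of \<open>s\<close> relative to
    \<open>ln \<bar>c p\<bar> / ln \<bar>c q\<bar>\<close>.\<close>
  define \<kappa> where "\<kappa> c = \<bar>c p\<bar> / \<bar>c q\<bar> powr s" for c :: "'n \<Rightarrow> real"
  let ?\<rho> = "\<lambda>c r j. measure lebesgue (E \<inter> diag_map (\<lambda>i. inverse (c i) ^ j) ` ball 0 r)
        / measure lebesgue (diag_map (\<lambda>i. inverse (c i) ^ j) ` ball 0 r)"
  let ?G = "\<lambda>\<kappa> r j. {u \<in> ball (0::real^'n) r. \<bar>u $ p\<bar> < \<kappa> ^ j * \<bar>u $ q\<bar> powr s}"
  have ratio: "?\<rho> c r j = measure lebesgue (?G (\<kappa> c) r j) / measure lebesgue (ball (0::real^'n) r)"
    if c: "\<And>i. \<bar>c i\<bar> > 1" for c r j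
  proof -
    have c0: "c i \<noteq> 0" for i using c[of i] by auto
    have "diag_map (\<lambda>i. inverse (c i) ^ j) u \<in> E \<longleftrightarrow> \<bar>u $ p\<bar> < \<kappa> c ^ j * \<bar>u $ q\<bar> powr s" for u
    proof -
      have "(\<bar>c q\<bar> ^ j) powr s = (\<bar>c q\<bar> powr s) ^ j"
        using c0[of q] by (simp add: powr_powr mult.commute flip: powr_realpow)
      then have pw: "(1 / \<bar>c q\<bar> ^ j) powr s = 1 / (\<bar>c q\<bar> powr s) ^ j"
        by (simp add: powr_divide)
      have "\<bar>inverse (c q) ^ j * u $ q\<bar> = 1 / \<bar>c q\<bar> ^ j * \<bar>u $ q\<bar>"
        by (simp add: abs_mult power_abs abs_inverse divide_inverse flip: power_inverse)
      then have mq: "\<bar>inverse (c q) ^ j * u $ q\<bar> powr s = \<bar>u $ q\<bar> powr s / (\<bar>c q\<bar> powr s) ^ j"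
        by (simp only: powr_mult pw) simp
      have mp: "\<bar>inverse (c p) ^ j * u $ p\<bar> = \<bar>u $ p\<bar> / \<bar>c p\<bar> ^ j"
        by (simp add: abs_mult power_abs abs_inverse divide_inverse flip: power_inverse)
      have "\<bar>c p\<bar> ^ j > 0" "(\<bar>c q\<bar> powr s) ^ j > 0"
        using c0 by auto
      then show ?thesis
        unfolding E_def mem_Collect_eq diag_map_nth mp mq \<kappa>_def power_divide by (simp add: field_simps)
    qed
    then show ?thesis
      using c0 by (subst diag_map_density_ratio[OF Em]) auto
  qed
  have \<kappa>0: "\<kappa> c > 0" if "\<And>i. \<bar>c i\<bar> > 1" for c
    using that[of p] that[of q] by (auto simp: \<kappa>_def intro!: divide_pos_pos)
  have ln\<kappa>: "ln (\<kappa> c) = ln \<bar>c p\<bar> - s * ln \<bar>c q\<bar>" if "\<And>i. \<bar>c i\<bar> > 1" for c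
  proof -
    have "c p \<noteq> 0" "c q \<noteq> 0"
      using that[of p] that[of q] by auto
    then show ?thesis
      by (simp add: \<kappa>_def ln_div ln_powr)
  qed
  have ball0: "measure lebesgue (ball (0::real^'n) r) > 0" if "r > 0" for r
    using content_ball_pos[OF that] by simp
  have "ln (\<kappa> b) > 0"
    using s(2) ln0(2)[of q] by (simp add: ln\<kappa>[OF b] field_simps)
  then have \<kappa>b: "\<kappa> b > 1"
    using \<kappa>0[OF b] by simp
  have "?\<rho> b r \<longlonglongrightarrow> 1" if r: "r > 0" for r
  proof -
    have "?\<rho> b r \<longlonglongrightarrow> measure lebesgue (ball (0::real^'n) r) / measure lebesgue (ball (0::real^'n) r)"
      unfolding ratio[OF b] using ball0[OF r]
      by (intro tendsto_divide curved_cone_density(1) s0 \<kappa>0 b \<kappa>b tendsto_const) auto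
    then show ?thesis using ball0[OF r] by simp
  qed
  moreover have "b i \<noteq> 0" "a i \<noteq> 0" for i
    using b[of i] a[of i] by auto
  ultimately have "E \<in> density_family (diag_map b)"
    using Em Epos by (simp add: diag_map_mem_density_family_iff)
  then have "E \<in> density_family (diag_map a)"
    using sub by blast
  then have "?\<rho> a 1 \<longlonglongrightarrow> 1"
    using \<open>\<And>i. a i \<noteq> 0\<close> by (simp add: diag_map_mem_density_family_iff)
  moreover have "?\<rho> a 1 \<longlonglongrightarrow> 0"
  proof -
    have "ln (\<kappa> a) < 0"
      using s(1) ln0(1)[of q] by (simp add: ln\<kappa>[OF a] field_simps)
    then have \<kappa>a: "\<kappa> a < 1"
      using \<kappa>0[OF a] by simp
    have "?\<rho> a 1 \<longlonglongrightarrow> 0 / measure lebesgue (ball (0::real^'n) 1)"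
      unfolding ratio[OF a] using ball0[of 1]
      by (intro tendsto_divide curved_cone_density(2) s0 \<kappa>0 a \<kappa>a tendsto_const) auto
    then show ?thesis by simp
  qed
  ultimately show False
    using LIMSEQ_unique by fastforce
qed

lemma density_family_diag_map_eq_iff:
  fixes a b :: "'n::finite \<Rightarrow> real"
  assumes a: "\<And>i. \<bar>a i\<bar> > 1" and b: "\<And>i. \<bar>b i\<bar> > 1"
  shows "density_family (diag_map a) = density_family (diag_map b) \<longleftrightarrow>
    (\<exists>t>0. \<forall>i. \<bar>b i\<bar> = \<bar>a i\<bar> powr t)"
proof
  assume eq: "density_family (diag_map a) = density_family (diag_map b)"
  have ln0: "ln \<bar>a i\<bar> > 0" "ln \<bar>b i\<bar> > 0" for i
    using a[of i] b[of i] by auto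
  \<comment> \<open>An arbitrary reference index: it determines \<open>t\<close>, and the equality
    of logarithmic ratios, obtained from both inclusions, carries this \<open>t\<close> over to all
    other indices.\<close>
  define q :: 'n where "q = undefined"
  define t where "t = ln \<bar>b q\<bar> / ln \<bar>a q\<bar>"
  have "\<bar>b i\<bar> = \<bar>a i\<bar> powr t" for i
  proof -
    have "ln \<bar>b i\<bar> / ln \<bar>b q\<bar> = ln \<bar>a i\<bar> / ln \<bar>a q\<bar>"
      using ln_ratio_le_of_density_family_subset[of a b i q, OF a b]
        ln_ratio_le_of_density_family_subset[of b a i q, OF b a] eq by simp
    then have "ln \<bar>b i\<bar> = t * ln \<bar>a i\<bar>"
      using ln0(1)[of q] ln0(2)[of q] by (simp add: t_def field_simps)
    then have "exp (ln \<bar>b i\<bar>) = \<bar>a i\<bar> powr t"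
      using a[of i] by (auto simp: powr_def)
    then show ?thesis
      using b[of i] by simp
  qed
  moreover have "t > 0"
    using ln0 by (simp add: t_def)
  ultimately show "\<exists>t>0. \<forall>i. \<bar>b i\<bar> = \<bar>a i\<bar> powr t" by blast
next
  assume "\<exists>t>0. \<forall>i. \<bar>b i\<bar> = \<bar>a i\<bar> powr t"
  then obtain t where t: "t > 0" "\<And>i. \<bar>b i\<bar> = \<bar>a i\<bar> powr t" by blast
  have inverse_power: "\<bar>a i\<bar> = \<bar>b i\<bar> powr (1 / t)" for i
    using t a[of i] by (simp add: powr_powr)
  show "density_family (diag_map a) = density_family (diag_map b)"
  proof
    show "density_family (diag_map a) \<subseteq> density_family (diag_map b)"
      by (rule density_family_powr_subset[OF a t])
    show "density_family (diag_map b) \<subseteq> density_family (diag_map a)"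
      using t(1) by (intro density_family_powr_subset[OF b _ inverse_power]) simp
  qed
qed

section \<open>Powers of natural numbers\<close>

text \<open>For every prime \<open>p\<close>, the number \<open>q\<close> divides
  \<open>multiplicity p x * m\<close> for all \<open>m\<close> in \<open>S\<close>, hence divides
  \<open>multiplicity p x\<close> times the gcd of \<open>S\<close>, which is 1.\<close>

lemma is_nth_power_of_coprime_powers:
  fixes x :: nat
  assumes q: "q > 0" and S: "Gcd S = (1::nat)" and pow: "\<And>m. m \<in> S \<Longrightarrow> is_nth_power q (x ^ m)"
  shows "is_nth_power q x"
proof (cases "x = 0")
  case True
  then show ?thesis using q by (auto simp: is_nth_power_def intro: exI[of _ 0])
next
  case False
  have "q dvd multiplicity p x" if p: "prime p" for p
  proof -
    have "q dvd multiplicity p x * m" if "m \<in> S" for m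
      using pow[OF that] p False q
      by (simp add: is_nth_power_conv_multiplicity_nat prime_elem_multiplicity_power_distrib mult.commute)
    then have "q dvd Gcd ((*) (multiplicity p x) ` S)"
      by (intro Gcd_greatest) auto
    then show ?thesis
      by (simp add: Gcd_mult S)
  qed
  then show ?thesis
    using q by (simp add: is_nth_power_conv_multiplicity_nat)
qed

text \<open>Dividing the exponents \<open>m i\<close> by their gcd makes them coprime. All powers
  \<open>x i0 ^ n i\<close> are then \<open>n i0\<close>-th powers, so \<open>x i0\<close> itself is
  one, and its root \<open>a\<close> is the common base.\<close>

lemma powers_of_common_base:
  fixes x :: "'n::finite \<Rightarrow> nat"
  assumes x: "\<And>i. x i > 1" and N: "N > 0" and m: "\<And>i. x i ^ N = x i0 ^ m i"
  obtains a :: nat and n :: "'n \<Rightarrow> nat" where "\<And>i. n i > 0" "Gcd (range n) = 1" "\<And>i. x i = a ^ n i"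
proof -
  have m0: "m i > 0" for i
    using m[of i] x[of i] N by (intro Nat.gr0I) auto
  define g where "g = Gcd (range m)"
  have g0: "g > 0"
    using m0 dvd_pos_nat Gcd_dvd unfolding g_def by (metis rangeI)
  define n where "n i = m i div g" for i
  have mn: "m i = g * n i" for i
    by (simp add: n_def g_def)
  have n0: "n i > 0" for i
    using m0[of i] mn[of i] by (auto intro: Nat.gr0I)
  have "range m = (*) g ` range n"
    by (auto simp: mn)
  then have "g = g * Gcd (range n)"
    using Gcd_mult[of g "range n"] by (simp add: g_def)
  then have G: "Gcd (range n) = 1"
    using g0 by simp
  \<comment> \<open>The relation at \<open>i0\<close> itself forces \<open>N = m i0\<close>, so the
    gcd \<open>g\<close> divides \<open>N\<close> as well and can be cancelled from all
    exponents.\<close>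
  have "x i0 ^ N = x i0 ^ m i0" using m by blast
  then have N_eq: "N = g * n i0"
    using x[of i0] mn power_inject_exp by metis
  have xn: "x i ^ n i0 = x i0 ^ n i" for i
  proof -
    have "(x i ^ n i0) ^ g = (x i0 ^ n i) ^ g"
      using m[of i] by (simp add: N_eq mn mult.commute flip: power_mult)
    then show ?thesis
      using g0 by (simp add: power_eq_iff_eq_base)
  qed
  have "is_nth_power (n i0) (x i0)"
  proof (rule is_nth_power_of_coprime_powers[OF n0 G])
    fix k assume "k \<in> range n"
    then show "is_nth_power (n i0) (x i0 ^ k)"
      using xn by (metis imageE is_nth_power_def)
  qed
  then obtain a where a: "x i0 = a ^ n i0"
    by (auto simp: is_nth_power_def)
  have "x i = a ^ n i" for i
  proof -
    have "x i ^ n i0 = (a ^ n i) ^ n i0"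
      unfolding xn a by (simp add: mult.commute flip: power_mult)
    then show ?thesis
      using n0 by (simp add: power_eq_iff_eq_base)
  qed
  then show ?thesis
    using n0 G that[of n a] by blast
qed

text \<open>Raising the relation to the power \<open>q\<close> gives \<open>y ^ q = x ^ p\<close>.
  So \<open>x ^ p\<close> and, trivially, \<open>x ^ q\<close> are \<open>q\<close>-th powers with
  coprime exponents.\<close>

lemma rational_powr_nat_is_nth_power:
  assumes x: "x > 0" and y: "real x powr (real p / real q) = real y"
    and pq: "coprime p q" "q > 0"
  shows "is_nth_power q x"
proof (rule is_nth_power_of_coprime_powers[where S = "{p, q}"])
  have "real (y ^ q) = (real x powr (real p / real q)) powr real q"
    using x y by (simp add: powr_realpow flip: y)
  also have "\<dots> = real (x ^ p)"
    using x pq by (simp add: powr_powr powr_realpow)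
  finally have "y ^ q = x ^ p"
    by (simp only: of_nat_eq_iff)
  then show "is_nth_power q (x ^ m)" if "m \<in> {p, q}" for m
    using that by (auto simp: is_nth_power_def) metis
qed (use pq in \<open>auto simp: coprime_iff_gcd_eq_1\<close>)

section \<open>Integral powers and the Four Exponentials Conjecture\<close>

lemma of_real_of_rat: "of_real (of_rat q) = (of_rat q :: 'a :: real_field)"
  by (cases q) (simp add: of_rat_rat)

text \<open>For the pairs \<open>1\<close>, \<open>t\<close> and \<open>ln x\<close>,
  \<open>ln y\<close> the four exponentials are the natural numbers \<open>x\<close>,
  \<open>y\<close>, \<open>x'\<close>, \<open>y'\<close>, all algebraic. Since \<open>1\<close> and
  \<open>t\<close> are independent over the rationals, the logarithms must be dependent.\<close>

lemma four_exponentials_ln_ratio_rational: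
  assumes four: four_exponentials_conjecture
    and x: "x > 1" "y > 1" and t: "t \<notin> \<rat>"
    and xt: "real x powr t = real x'" and yt: "real y powr t = real y'"
  shows "ln (real x) / ln (real y) \<in> \<rat>"
proof -
  have exp_ln_t: "exp (complex_of_real t * complex_of_real (ln (real z))) = of_nat z'"
    if "z > 1" "real z powr t = real z'" for z z' :: nat
  proof -
    have "exp (t * ln (real z)) = real z'"
      using that by (simp add: powr_def)
    then show ?thesis
      by (metis exp_of_real of_real_mult of_real_of_nat_eq)
  qed
  have exp_ln: "exp (1 * complex_of_real (ln (real z))) = of_nat z" if "z > 1" for z :: nat
    using that by (simp only: mult_1_left exp_of_real) simp
  have "rat_independent2 1 (complex_of_real t)"
    unfolding rat_independent2_def
  proof (intro allI impI)
    fix p q :: rat assume "of_rat p * 1 + of_rat q * complex_of_real t = 0"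
    then have "complex_of_real (of_rat p + of_rat q * t) = 0"
      by (simp add: of_real_of_rat)
    then have eq: "of_rat p + of_rat q * t = 0"
      by (simp only: of_real_eq_0_iff)
    have "q = 0"
    proof (rule ccontr)
      assume "q \<noteq> 0"
      then have "t = of_rat (- p / q)"
        using eq by (simp add: of_rat_divide of_rat_minus field_simps)
      then show False using t by simp
    qed
    with eq show "p = 0 \<and> q = 0" by simp
  qed
  moreover have "\<not> (\<not> algebraic (exp (1 * complex_of_real (ln (real x)))) \<or>
      \<not> algebraic (exp (1 * complex_of_real (ln (real y)))) \<or>
      \<not> algebraic (exp (complex_of_real t * complex_of_real (ln (real x)))) \<or>
      \<not> algebraic (exp (complex_of_real t * complex_of_real (ln (real y)))))"
    by (simp only: exp_ln[OF x(1)] exp_ln[OF x(2)] exp_ln_t[OF x(1) xt] exp_ln_t[OF x(2) yt]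
        algebraic_of_nat simp_thms)
  ultimately have "\<not> rat_independent2 (complex_of_real (ln (real x))) (complex_of_real (ln (real y)))"
    using four unfolding four_exponentials_conjecture_def by blast
  then obtain p q :: rat
    where "of_rat p * complex_of_real (ln (real x)) + of_rat q * complex_of_real (ln (real y)) = 0"
      and pq: "\<not> (p = 0 \<and> q = 0)"
    unfolding rat_independent2_def by blast
  then have "complex_of_real (of_rat p * ln (real x) + of_rat q * ln (real y)) = 0"
    by (simp add: of_real_of_rat)
  then have eq: "of_rat p * ln (real x) + of_rat q * ln (real y) = 0"
    by (simp only: of_real_eq_0_iff)
  have ln0: "ln (real x) > 0" "ln (real y) > 0"
    using x by auto
  \<comment> \<open>If \<open>p\<close> vanished, the relation and \<open>ln y > 0\<close> would
    force \<open>q = 0\<close> too.\<close>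
  have "p \<noteq> 0"
    using eq ln0 pq by auto
  then have "ln (real x) / ln (real y) = of_rat (- q / p)"
    using eq ln0 by (simp add: of_rat_divide of_rat_minus field_simps)
  then show ?thesis by simp
qed

lemma nat_common_power_of_ln_ratios:
  fixes x :: "'n::finite \<Rightarrow> nat"
  assumes x: "\<And>i. x i > 1" and rat: "\<And>i. ln (real (x i)) / ln (real (x i0)) \<in> \<rat>"
  obtains N m where "N > 0" "\<And>i. x i ^ N = x i0 ^ m i"
proof -
  have ln0: "ln (real (x i)) > 0" for i
    using x[of i] by simp
  have "\<exists>p q. q > 0 \<and> ln (real (x i)) / ln (real (x i0)) = real p / real q" for i
    using rat[of i] ln0 by (metis Rats_abs_nat_div_natE abs_of_pos divide_pos_pos gr0I)
  then obtain p q where q: "\<And>i. q i > 0"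
    and pq: "\<And>i. ln (real (x i)) / ln (real (x i0)) = real (p i) / real (q i :: nat)"
    by metis
  \<comment> \<open>A common denominator of all the ratios.\<close>
  define N where "N = (\<Prod>i\<in>UNIV. q i)"
  have "x i ^ N = x i0 ^ (p i * (N div q i))" for i
  proof -
    have N: "q i * (N div q i) = N"
      unfolding N_def by (simp add: dvd_prodI)
    have "real (q i) * ln (real (x i)) = real (p i) * ln (real (x i0))"
      using pq[of i] q[of i] ln0[of i0] by (simp add: field_simps)
    then have "ln (real (x i ^ q i)) = ln (real (x i0 ^ p i))"
      using x[of i] x[of i0] by (simp add: ln_realpow)
    then have "real (x i ^ q i) = real (x i0 ^ p i)"
      using x[of i] x[of i0] by (subst (asm) ln_inj_iff) auto
    then have "x i ^ q i = x i0 ^ p i"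
      by (simp only: of_nat_eq_iff)
    then show ?thesis
      by (metis N power_mult)
  qed
  moreover have "N > 0"
    using q by (auto simp: N_def intro!: prod_pos)
  ultimately show thesis
    using that[of N "\<lambda>i. p i * (N div q i)"] by blast
qed

lemma powr_nat_exponent_cases:
  fixes x y :: "'n::finite \<Rightarrow> nat"
  assumes four: four_exponentials_conjecture
    and x: "\<And>i. x i > 1" and t: "t > 0" and y: "\<And>i. real (y i) = real (x i) powr t"
  shows "(\<exists>p q :: nat. p > 0 \<and> q > 0 \<and> t = real p / real q \<and> (\<forall>j. \<exists>k. x j = k ^ q)) \<or>
    (\<exists>a b (n :: 'n \<Rightarrow> nat) m :: nat. (\<forall>j. n j > 0) \<and> (\<forall>j. x j = a ^ n j) \<and> m > 0 \<and>
       t = real m / real (Gcd (range n)) * (ln (real b) / ln (real a)))"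
proof (cases "t \<in> \<rat>")
  case True
  then obtain p q where pq: "q \<noteq> 0" "\<bar>t\<bar> = real p / real q" "coprime p q"
    by (rule Rats_abs_nat_div_natE)
  have "is_nth_power q (x j)" for j
    using x[of j] y[of j] t pq by (intro rational_powr_nat_is_nth_power[where p = p and y = "y j"]) auto
  then have "\<forall>j. \<exists>k. x j = k ^ q"
    by (simp add: is_nth_power_def)
  moreover have "p > 0" "t = real p / real q"
    using t pq by (auto intro: gr0I)
  ultimately show ?thesis
    using pq by blast
next
  case False
  define i0 :: 'n where "i0 = undefined"
  have "ln (real (x i)) / ln (real (x i0)) \<in> \<rat>" for i
    using y by (intro four_exponentials_ln_ratio_rational[OF four x x False, of _ "y i" _ "y i0"]) auto
  then obtain N m where "N > 0" "\<And>i. x i ^ N = x i0 ^ m i"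
    using nat_common_power_of_ln_ratios[of x i0, OF x] by metis
  then obtain a n where n: "\<And>i. n i > 0" "Gcd (range n) = 1" "\<And>i. x i = a ^ n i"
    using powers_of_common_base[of x N i0 m, OF x] by metis
  have "a \<noteq> 0" "a \<noteq> 1"
    using x[of i0] n(1,3)[of i0] by (auto simp: zero_power intro: gr0I)
  then have a1: "a > 1" by simp
  have y': "real (y i) = (real a powr t) ^ n i" for i
    using a1 by (simp add: y n(3) powr_powr mult.commute flip: powr_realpow)
  \<comment> \<open>Both sides equal \<open>real a powr t\<close> raised to
    \<open>n i * n i0\<close>. Coprimality of the \<open>n i\<close> then makes \<open>y i0\<close>
    an \<open>n i0\<close>-th power, and comparing roots shows that \<open>real a powr t\<close> is
    the natural number \<open>b\<close>.\<close>
  have "y i ^ n i0 = y i0 ^ n i" for i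
  proof -
    have "real (y i ^ n i0) = real (y i0 ^ n i)"
      by (simp add: y' mult.commute flip: power_mult)
    then show ?thesis by (simp only: of_nat_eq_iff)
  qed
  then have "is_nth_power (n i0) (y i0 ^ k)" if "k \<in> range n" for k
    using that by (metis imageE is_nth_power_def)
  then have "is_nth_power (n i0) (y i0)"
    by (rule is_nth_power_of_coprime_powers[OF n(1,2)])
  then obtain b where b: "y i0 = b ^ n i0"
    by (auto simp: is_nth_power_def)
  have "real b ^ n i0 = (real a powr t) ^ n i0"
    using y'[of i0] b by simp
  then have "real b = real a powr t"
    using n(1)[of i0] by (simp add: power_eq_iff_eq_base)
  then have "ln (real b) = t * ln (real a)"
    using a1 by (simp add: ln_powr)
  \<comment> \<open>The gcd of the exponents is 1, so the second alternative holds with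
    \<open>m = 1\<close>.\<close>
  then have "t = real 1 / real (Gcd (range n)) * (ln (real b) / ln (real a))"
    using a1 n(2) by simp
  then show ?thesis
    using n(1,3) zero_less_one by blast
qed

section \<open>Equivalent MRA and trivial equivalence\<close>

theorem proposition24:
  fixes A1 A2 :: "real ^ 'n \<Rightarrow> real ^ 'n"
  assumes "four_exponentials_conjecture"
    and "linear A1" and "linear A2"
    and "adjoint A1 = A1" and "adjoint A2 = A2"
    and "expansive A1" and "expansive A2"
    and "\<exists>c1. A1 = diag_map c1" and "\<exists>c2. A2 = diag_map c2"
  shows "generate_equivalent_MRA A1 A2 \<longleftrightarrow>
    (\<exists>t>0. map_powr (abs_map A1) t = abs_map A2) \<and> trivially_equivalent A1 A2"
proof -
  obtain a b where A: "A1 = diag_map a" "A2 = diag_map b"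
    using assms(8,9) by blast
  have a: "\<bar>a i\<bar> > 1" and b: "\<bar>b i\<bar> > 1" for i
    using assms(6,7) expansive_diag_mapD unfolding A by blast+
  have power_iff: "map_powr (abs_map A1) t = abs_map A2 \<longleftrightarrow> (\<forall>i. \<bar>b i\<bar> = \<bar>a i\<bar> powr t)" for t
    unfolding A abs_map_diag_map map_powr_diag_map diag_map_eq_iff by (auto simp: fun_eq_iff)
  have MRA: "generate_equivalent_MRA A1 A2 \<longleftrightarrow>
      (\<forall>i. a i \<in> \<int>) \<and> (\<forall>i. b i \<in> \<int>) \<and> (\<exists>t>0. \<forall>i. \<bar>b i\<bar> = \<bar>a i\<bar> powr t)"
    unfolding generate_equivalent_MRA_def A diag_map_integer_lattice_iff
      density_family_diag_map_eq_iff[of a b, OF a b] ..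
  have Ints_abs: "c \<in> \<int> \<longleftrightarrow> (\<exists>k::nat. \<bar>c\<bar> = real k)" for c :: real
  proof
    assume "c \<in> \<int>"
    then have "\<bar>c\<bar> \<in> \<nat>" by (simp add: Nats_altdef2)
    then show "\<exists>k::nat. \<bar>c\<bar> = real k" by (auto elim: Nats_cases)
  next
    assume "\<exists>k::nat. \<bar>c\<bar> = real k"
    then obtain k :: nat where "\<bar>c\<bar> = real k" by blast
    then have "c = real k \<or> c = - real k" by linarith
    then show "c \<in> \<int>" by auto
  qed
  show ?thesis
  proof
    assume "generate_equivalent_MRA A1 A2"
    then obtain t where ab: "\<And>i. a i \<in> \<int>" "\<And>i. b i \<in> \<int>"
      and t: "t > 0" "\<And>i. \<bar>b i\<bar> = \<bar>a i\<bar> powr t"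
      unfolding MRA by blast
    obtain x y where x: "\<And>i. \<bar>a i\<bar> = real (x i)" and y: "\<And>i. \<bar>b i\<bar> = real (y i)"
      using ab unfolding Ints_abs by metis
    have x1: "x i > 1" for i
      using a[of i] unfolding x by simp
    have "(\<exists>p q :: nat. p > 0 \<and> q > 0 \<and> t = real p / real q \<and> (\<forall>j. \<exists>k. x j = k ^ q)) \<or>
      (\<exists>a b (n :: 'n \<Rightarrow> nat) m :: nat. (\<forall>j. n j > 0) \<and> (\<forall>j. x j = a ^ n j) \<and> m > 0 \<and>
       t = real m / real (Gcd (range n)) * (ln (real b) / ln (real a)))"
      using t(2) unfolding x y by (intro powr_nat_exponent_cases[OF assms(1) x1 t(1)]) auto
    then have "trivially_equivalent A1 A2"
      unfolding trivially_equivalent_def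
      \<comment> \<open>Both maps are already diagonal, so the identity serves as the change of
        basis.\<close>
      by (intro exI[of _ id] exI[of _ a] exI[of _ b] conjI exI[of _ t] t(1) power_iff[THEN iffD2] allI t(2))
        (simp_all only: A diagonalizes_id x of_nat_eq_iff)
    then show "(\<exists>t>0. map_powr (abs_map A1) t = abs_map A2) \<and> trivially_equivalent A1 A2"
      using t power_iff by blast
  next
    assume "(\<exists>t>0. map_powr (abs_map A1) t = abs_map A2) \<and> trivially_equivalent A1 A2"
    then obtain C l t where C: "diagonalizes C l (diag_map a)"
      and t: "t > 0" "\<And>i. \<bar>b i\<bar> = \<bar>a i\<bar> powr t"
      and cases: "(\<exists>p q :: nat. p > 0 \<and> q > 0 \<and> t = real p / real q \<and>
              (\<forall>j. \<exists>k :: nat. \<bar>l j\<bar> = real (k ^ q))) \<or>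
           (\<exists>(a :: nat) (b :: nat) (n :: 'n \<Rightarrow> nat) m :: nat.
              (\<forall>j. n j > 0) \<and> (\<forall>j. \<bar>l j\<bar> = real (a ^ n j)) \<and> m > 0 \<and>
              t = real m / real (Gcd (range n)) * (ln (real b) / ln (real a)))"
      unfolding trivially_equivalent_def power_iff unfolding A by blast
    \<comment> \<open>The power relation already gives equal density families; what remains is that
      both maps preserve the integer lattice. Each alternative displays
      \<open>\<bar>a i\<bar>\<close> and \<open>\<bar>b i\<bar>\<close> as natural numbers, once
      \<open>a i\<close> is located among the entries of \<open>l\<close>.\<close>
    have "(\<exists>k::nat. \<bar>a i\<bar> = real k) \<and> (\<exists>k::nat. \<bar>b i\<bar> = real k)" for i
    proof -
      obtain j where j: "l j = a i"
        using diagonalizes_diag_map_entry[OF C] by blast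
      from cases show ?thesis
      proof (elim disjE exE conjE)
        fix p q :: nat assume "p > 0" "q > 0" and tpq: "t = real p / real q"
          and "\<forall>j. \<exists>k :: nat. \<bar>l j\<bar> = real (k ^ q)"
        then obtain k where k: "\<bar>a i\<bar> = real (k ^ q)"
          using j by metis
        then have "k > 0"
          using a[of i] \<open>q > 0\<close> by (cases "k = 0") (auto simp: zero_power)
        then have "\<bar>b i\<bar> = real (k ^ p)"
          using \<open>q > 0\<close> by (simp add: t(2) k tpq powr_powr flip: powr_realpow)
        with k show ?thesis by blast
      next
        fix u v :: nat and n :: "'n \<Rightarrow> nat" and m :: nat
        assume "\<forall>j. n j > 0" and u: "\<forall>j. \<bar>l j\<bar> = real (u ^ n j)" and "m > 0"
          and tu: "t = real m / real (Gcd (range n)) * (ln (real v) / ln (real u))"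
        define g where "g = Gcd (range n)"
        \<comment> \<open>The denominator \<open>g\<close> of \<open>t\<close> cancels against
          \<open>n j\<close>, which leaves
          \<open>\<bar>b i\<bar> = real (v ^ (m * k))\<close>.\<close>
        obtain k where k: "n j = g * k"
          unfolding g_def by (meson Gcd_dvd dvdE rangeI)
        have "g > 0"
          using \<open>\<forall>j. n j > 0\<close> k by (metis gr0I mult_0 less_irrefl)
        have ai: "\<bar>a i\<bar> = real (u ^ n j)"
          using u j by metis
        have "u \<noteq> 0" "u \<noteq> 1"
          using a[of i] ai \<open>\<forall>j. n j > 0\<close> by (auto simp: zero_power intro: gr0I)
        then have "u > 1" by simp
        \<comment> \<open>Since \<open>ln 0\<close> has the value 0, \<open>v = 0\<close> would give
          \<open>t = 0\<close>.\<close>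
        have "v > 0"
          using t(1) tu by (auto intro: gr0I)
        have "\<bar>b i\<bar> = exp (t * (real (n j) * ln (real u)))"
          using \<open>u > 1\<close> by (simp add: t(2) ai powr_def ln_realpow)
        also have "t * (real (n j) * ln (real u)) = real (m * k) * ln (real v)"
          using \<open>g > 0\<close> \<open>u > 1\<close> by (simp add: tu k field_simps flip: g_def)
        also have "exp \<dots> = real (v ^ (m * k))"
          using \<open>v > 0\<close> by (simp only: exp_of_nat_mult) simp
        finally show ?thesis
          using ai by blast
      qed
    qed
    then show "generate_equivalent_MRA A1 A2"
      unfolding MRA Ints_abs using t by blast
  qed
qed

end
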